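(* Let $p$ be any odd prime, and let $x\in\mathbb{Z}$. If $x\not\equiv 1/2\pmod p$ (i.e. $p\nmid 2x-1$), then $$\sum_{k=0}^{p-1}S_k^{(0)}(x)\equiv\frac{x}{2x-1}\left(1+\left(\frac{1-4x^2}{p}\right)\right)\pmod p,$$ where $\left(\frac{\cdot}{p}\right)$ denotes the Legendre symbol. When $x\equiv1/2\pmod p$ (i.e. $p\mid 2x-1$), we have $$\sum_{k=0}^{p-1}S_k^{(0)}(x)\equiv-\delta_{p,3}\pmod p.$$
   Context: For $n\in\mathbb{N}=\{0,1,2,\ldots\}$, $$S_n^{(0)}(x)=\sum_{i=0}^n\sum_{j=0}^n\binom{i+j}ix^{i+j}.$$ Here $\delta_{p,3}$ is the Kronecker delta ($1$ if $p=3$, and $0$ otherwise). The Legendre symbol $\left(\frac{a}{p}\right)$ is $0$ when $p\mid a$. Congruences modulo $p$ between rational numbers whose denominators are coprime to $p$ are understood in the ring of $p$-adic integers (equivalently, division is carried out modulo $p$). *)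

theory Defs
  imports Complex_Main "HOL-Number_Theory.Number_Theory"
begin

definition S0 :: "nat \<Rightarrow> 'a::comm_semiring_1 \<Rightarrow> 'a" where
  "S0 n x = (\<Sum>i=0..n. \<Sum>j=0..n. of_nat ((i + j) choose i) * x ^ (i + j))"

definition p_integral :: "nat \<Rightarrow> rat \<Rightarrow> bool" where
  "p_integral p r \<longleftrightarrow> coprime (snd (quotient_of r)) (int p)"

text \<open>
  Congruence modulo \<open>p\<close> of rationals with denominators prime to \<open>p\<close>: the difference
  is \<open>p\<close> times a \<open>p\<close>-integral rational. For rational numbers and prime \<open>p\<close>, this is
  congruence modulo \<open>p\<close> in the ring of \<open>p\<close>-adic integers.
\<close>

definition rat_cong :: "nat \<Rightarrow> rat \<Rightarrow> rat \<Rightarrow> bool" where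
  "rat_cong p a b \<longleftrightarrow>
     p_integral p a \<and> p_integral p b \<and> (\<exists>c. p_integral p c \<and> a - b = of_nat p * c)"

lemma p_integral_of_int [simp]: "p_integral p (of_int a)"
  by (simp add: p_integral_def)

lemma rat_cong_of_int_iff:
  assumes "p > 0"
  shows "rat_cong p (of_int a) (of_int b) \<longleftrightarrow> [a = b] (mod int p)"
proof
  assume "rat_cong p (of_int a) (of_int b)"
  then obtain c where c: "p_integral p c" "of_int a - of_int b = of_nat p * c"
    by (auto simp: rat_cong_def)
  obtain m n where q: "quotient_of c = (m, n)" by (cases "quotient_of c")
  have n: "n > 0" "coprime n (int p)" "c = of_int m / of_int n"
    using q c(1) quotient_of_denom_pos[OF q] quotient_of_div[OF q] by (auto simp: p_integral_def)
  have "of_int ((a - b) * n) = (of_int (int p * m) :: rat)"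
    using c(2) n by (simp add: field_simps)
  then have "(a - b) * n = int p * m"
    by (simp only: of_int_eq_iff)
  then have "int p dvd (a - b) * n" by simp
  then have "int p dvd a - b"
    using n(2) by (simp add: coprime_dvd_mult_left_iff coprime_commute)
  then show "[a = b] (mod int p)" by (simp add: cong_iff_dvd_diff)
next
  assume "[a = b] (mod int p)"
  then obtain k where "a - b = int p * k" by (auto simp: cong_iff_dvd_diff)
  then have "of_int a - of_int b = of_nat p * (of_int k :: rat)"
    by (metis of_int_diff of_int_mult of_int_of_nat_eq)
  then show "rat_cong p (of_int a) (of_int b)"
    unfolding rat_cong_def by (intro conjI exI[of _ "of_int k"]) simp_all
qed

end

theory Submission
  imports Defs
begin

text \<open>
  Exchanging the summations gives the weight \<open>p - max i j \<equiv> - max i j\<close>, and the binomials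
  with \<open>i + j \<ge> p\<close> vanish modulo \<open>p\<close>. On the diagonal \<open>i + j = n\<close> we write
  \<open>2 * max i j = n + \<bar>n - 2 * i\<bar>\<close>. The first summand contributes \<open>\<Sum>n<p. n * (2 * x)^n\<close>, and the
  second, the mean absolute deviation of the binomial distribution, is a multiple of a central
  binomial coefficient. For \<open>h = (p - 1) / 2\<close> and \<open>m \<le> h\<close> we have
  \<open>(2 * m choose m) \<equiv> (-4)^m * (h choose m)\<close>, so the binomial theorem turns the central binomials
  into \<open>(1 - 4 * x^2)^h\<close>, which is the Legendre symbol by Euler's criterion.
\<close>

section \<open>Exchanging the order of summation\<close>

text \<open>The pair (i, j) occurs for exactly those k with max i j <= k < N.\<close>

lemma sum_squares_eq_sum_max:
  fixes f :: "nat \<Rightarrow> nat \<Rightarrow> int"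
  shows "(\<Sum>k<N. \<Sum>i\<le>k. \<Sum>j\<le>k. f i j) = (\<Sum>i<N. \<Sum>j<N. int (N - max i j) * f i j)"
proof -
  have "(\<Sum>k<N. \<Sum>i\<le>k. \<Sum>j\<le>k. f i j) =
      (\<Sum>k<N. \<Sum>i<N. \<Sum>j<N. if max i j \<le> k then f i j else 0)"
  proof (rule sum.cong[OF refl])
    fix k assume "k \<in> {..<N}"
    then have *: "{..<N} \<inter> {i. i \<le> k} = {..k}" by auto
    have "(\<Sum>i<N. \<Sum>j<N. if max i j \<le> k then f i j else 0) =
        (\<Sum>i<N. if i \<le> k then (\<Sum>j<N. if j \<le> k then f i j else 0) else 0)"
      by (intro sum.cong refl) auto
    then show "(\<Sum>i\<le>k. \<Sum>j\<le>k. f i j) = (\<Sum>i<N. \<Sum>j<N. if max i j \<le> k then f i j else 0)"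
      by (simp add: sum.If_cases *)
  qed
  also have "\<dots> = (\<Sum>i<N. \<Sum>k<N. \<Sum>j<N. if max i j \<le> k then f i j else 0)"
    by (rule sum.swap)
  also have "\<dots> = (\<Sum>i<N. \<Sum>j<N. \<Sum>k<N. if max i j \<le> k then f i j else 0)"
    by (intro sum.cong refl sum.swap)
  also have "\<dots> = (\<Sum>i<N. \<Sum>j<N. int (N - max i j) * f i j)"
  proof (intro sum.cong refl)
    fix i j
    have *: "{..<N} \<inter> {k. max i j \<le> k} = {max i j..<N}" by auto
    show "(\<Sum>k<N. if max i j \<le> k then f i j else 0) = int (N - max i j) * f i j"
      by (simp add: sum.If_cases * del: max.bounded_iff)
  qed
  finally show ?thesis .
qed

section \<open>Absolute deviation of the binomial distribution\<close>

text \<open>Divided by 2^n, this is the mean distance from the origin of a simple random walk after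
  n steps; without the division it stays an integer.\<close>

definition abs_dev :: "nat \<Rightarrow> int" where
  "abs_dev n = (\<Sum>i\<le>n. \<bar>int n - 2 * int i\<bar> * int (n choose i))"

text \<open>One more step of the walk, by Pascal's rule: a position d contributes |d + 1| + |d - 1|,
  which is 2|d| for d nonzero and 2 for d = 0. Only walks back at the origin give the extra
  term.\<close>

lemma abs_dev_Suc:
  "abs_dev (Suc n) = 2 * abs_dev n + (if even n then 2 * int (n choose (n div 2)) else 0)"
proof -
  let ?c = "\<lambda>i. int (n choose i)"
  let ?e = "\<lambda>i. \<bar>int n + 1 - 2 * int i\<bar>"
  have "abs_dev (Suc n) = int n + 1 + (\<Sum>i\<le>n. ?e (Suc i) * int (Suc n choose Suc i))"
    unfolding abs_dev_def by (subst sum.atMost_Suc_shift) (simp add: algebra_simps)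
  also have "\<dots> = (int n + 1 + (\<Sum>i\<le>n. ?e (Suc i) * ?c (Suc i))) + (\<Sum>i\<le>n. ?e (Suc i) * ?c i)"
    by (simp add: ring_distribs sum.distrib)
  \<comment> \<open>The isolated \<open>int n + 1\<close> is the term i = 0. The new top term i = n
    + 1 then drops out, its binomial coefficient being 0.\<close>
  also have "int n + 1 + (\<Sum>i\<le>n. ?e (Suc i) * ?c (Suc i)) = (\<Sum>i\<le>Suc n. ?e i * ?c i)"
    by (subst sum.atMost_Suc_shift) simp
  also have "\<dots> = (\<Sum>i\<le>n. ?e i * ?c i)" by simp
  also have "\<dots> + (\<Sum>i\<le>n. ?e (Suc i) * ?c i) =
      (\<Sum>i\<le>n. 2 * (\<bar>int n - 2 * int i\<bar> * ?c i) + (if n = 2 * i then 2 * ?c i else 0))"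
    unfolding sum.distrib[symmetric]
  proof (intro sum.cong refl)
    fix i
    have "?e i + ?e (Suc i) = 2 * \<bar>int n - 2 * int i\<bar> + (if n = 2 * i then 2 else 0)"
    proof (cases "n = 2 * i")
      case False
      then have "int n + 1 \<le> 2 * int i \<or> 2 * int i + 1 \<le> int n" by linarith
      with False show ?thesis by auto
    qed simp
    then show "?e i * ?c i + ?e (Suc i) * ?c i =
        2 * (\<bar>int n - 2 * int i\<bar> * ?c i) + (if n = 2 * i then 2 * ?c i else 0)"
      by (simp add: ring_distribs[symmetric] split: if_splits)
  qed
  also have "\<dots> = 2 * abs_dev n + (\<Sum>i\<le>n. if n = 2 * i then 2 * ?c i else 0)"
    by (simp add: abs_dev_def sum.distrib sum_distrib_left)
  also have "(\<Sum>i\<le>n. if n = 2 * i then 2 * ?c i else 0) =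
      (if even n then 2 * int (n choose (n div 2)) else 0)"
  proof (cases "even n")
    case True
    then have "(\<Sum>i\<le>n. if n = 2 * i then 2 * ?c i else 0) =
        (\<Sum>i\<le>n. if i = n div 2 then 2 * ?c i else 0)"
      by (intro sum.cong refl) auto
    with True show ?thesis by simp
  qed (auto intro!: sum.neutral)
  finally show ?thesis .
qed

text \<open>Two absorptions joined by a symmetry. This ratio of consecutive central binomials drives
  both the closed form of \<open>abs_dev\<close> and the congruence for central binomials.\<close>

lemma central_binomial_Suc:
  "(m + 1) * (2 * Suc m choose Suc m) = 2 * (2 * m + 1) * (2 * m choose m)"
proof -
  have "Suc m * (Suc (Suc (2 * m)) choose Suc m) = Suc (Suc (2 * m)) * (Suc (2 * m) choose m)"
    by (simp only: Suc_times_binomial_eq mult.commute)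
  moreover have "(Suc (2 * m) choose m) = (Suc (2 * m) choose Suc m)"
    using binomial_symmetric[of m "Suc (2 * m)"] by (simp add: Suc_diff_le)
  moreover have "Suc m * (Suc (2 * m) choose Suc m) = Suc (2 * m) * (2 * m choose m)"
    by (simp only: Suc_times_binomial_eq mult.commute)
  moreover have "Suc (Suc (2 * m)) = 2 * Suc m" by simp
  ultimately have "Suc m * (2 * Suc m choose Suc m) = 2 * (Suc (2 * m) * (2 * m choose m))"
    by (metis mult.assoc)
  then show ?thesis by (simp only: Suc_eq_plus1 mult.assoc)
qed

lemma abs_dev_even: "abs_dev (2 * m) = 2 * int m * int (2 * m choose m)"
proof (induction m)
  case 0
  show ?case by (simp add: abs_dev_def)
next
  case (Suc m)
  have "abs_dev (2 * Suc m) = 4 * abs_dev (2 * m) + 4 * int (2 * m choose m)"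
    by (simp add: abs_dev_Suc)
  also have "\<dots> = 2 * int (2 * (2 * m + 1) * (2 * m choose m))"
    unfolding Suc by (simp add: algebra_simps)
  also have "\<dots> = 2 * int (Suc m) * int (2 * Suc m choose Suc m)"
    unfolding central_binomial_Suc[symmetric] of_nat_mult by simp
  finally show ?case .
qed

lemma abs_dev_odd: "abs_dev (Suc (2 * m)) = 2 * (2 * int m + 1) * int (2 * m choose m)"
  unfolding abs_dev_Suc abs_dev_even by (simp add: algebra_simps)

lemma sum_max_binomial:
  "2 * (\<Sum>i\<le>n. int (max i (n - i)) * int (n choose i)) = int n * 2 ^ n + abs_dev n"
proof -
  have "2 * (\<Sum>i\<le>n. int (max i (n - i)) * int (n choose i)) =
      (\<Sum>i\<le>n. int n * int (n choose i) + \<bar>int n - 2 * int i\<bar> * int (n choose i))"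
    unfolding sum_distrib_left
  proof (intro sum.cong refl)
    fix i assume "i \<in> {..n}"
    then have "2 * int (max i (n - i)) = int n + \<bar>int n - 2 * int i\<bar>" by auto
    then show "2 * (int (max i (n - i)) * int (n choose i)) =
        int n * int (n choose i) + \<bar>int n - 2 * int i\<bar> * int (n choose i)"
      by (metis mult.assoc ring_distribs(2))
  qed
  also have "\<dots> = int n * int (\<Sum>i\<le>n. n choose i) + abs_dev n"
    by (simp add: sum.distrib sum_distrib_left abs_dev_def)
  finally show ?thesis by (simp only: choose_row_sum of_nat_power) simp
qed

section \<open>Binomial coefficients modulo p\<close>

text \<open>p divides (i + j)! but neither i! nor j!.\<close>

lemma prime_dvd_choose_add:
  fixes p :: nat
  assumes "prime p" "i < p" "j < p" "p \<le> i + j"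
  shows "p dvd (i + j choose i)"
proof -
  have "fact i * fact j * (i + j choose i) = (fact (i + j) :: nat)"
    using binomial_fact_lemma[of i "i + j"] by simp
  moreover have "p dvd (fact (i + j) :: nat)" "\<not> p dvd (fact i :: nat)" "\<not> p dvd (fact j :: nat)"
    using assms by (auto simp: prime_dvd_fact_iff)
  ultimately show ?thesis
    using assms(1) by (metis prime_dvd_mult_iff)
qed

text \<open>Both sides are 1 at m = 0, and their consecutive ratios agree modulo p: over the common
  denominator m + 1, the numerators 2(2m + 1) and -4(h - m) differ by 4h + 2 = 2p. As m + 1 <= h <
  p, that denominator can be cancelled.\<close>

lemma central_binomial_cong:
  assumes "prime p" "p = 2 * h + 1" "m \<le> h"
  shows "[int (2 * m choose m) = (-4) ^ m * int (h choose m)] (mod int p)"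
  using assms(3)
proof (induction m)
  case (Suc m)
  have "int (Suc m) * int (h choose Suc m) = int (h - m) * int (h choose m)"
    by (metis binomial_absorb_comp binomial_absorption of_nat_mult)
  moreover have "int (Suc m) * ((-4) ^ Suc m * int (h choose Suc m)) =
      (-4) ^ Suc m * (int (Suc m) * int (h choose Suc m))"
    by (rule mult.left_commute)
  ultimately have R: "int (Suc m) * ((-4) ^ Suc m * int (h choose Suc m)) =
      (-4 * (int h - int m)) * ((-4) ^ m * int (h choose m))"
    using Suc.prems by (simp only: of_nat_diff Suc_leD power_Suc) (simp only: ac_simps mult_minus_left)
  have L: "int (Suc m) * int (2 * Suc m choose Suc m) = 2 * (2 * int m + 1) * int (2 * m choose m)"
    using arg_cong[OF central_binomial_Suc[of m], of int]
    by (simp add: algebra_simps del: binomial_Suc_Suc)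
  have "2 * (2 * int m + 1) - (-4 * (int h - int m)) = int p * 2"
    using assms(2) by simp
  then have c: "[2 * (2 * int m + 1) = -4 * (int h - int m)] (mod int p)"
    by (simp only: cong_iff_dvd_diff) simp
  have "[int (Suc m) * int (2 * Suc m choose Suc m) =
      int (Suc m) * ((-4) ^ Suc m * int (h choose Suc m))] (mod int p)"
    unfolding L R using Suc by (intro cong_mult[OF c]) simp
  moreover have "\<not> p dvd Suc m"
    using assms(2) Suc.prems by (auto dest: dvd_imp_le)
  then have "coprime (Suc m) p"
    using prime_imp_coprime[OF assms(1)] coprime_commute by blast
  ultimately show ?case
    by (metis cong_mult_lcancel coprime_int_iff)
qed simp

section \<open>Evaluation of the two power sums\<close>

text \<open>This is y times the derivative of the binomial expansion of (1 + y)^h, obtained by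
  absorption.\<close>

lemma sum_times_binomial:
  fixes y :: int
  assumes "h > 0"
  shows "(\<Sum>m\<le>h. int m * (int (h choose m) * y ^ m)) = int h * y * (1 + y) ^ (h - 1)"
proof -
  obtain g where h: "h = Suc g" using assms gr0_implies_Suc by blast
  have "(\<Sum>m\<le>h. int m * (int (h choose m) * y ^ m)) =
      (\<Sum>m\<le>g. int (Suc m * (Suc g choose Suc m)) * y ^ Suc m)"
    unfolding h sum.atMost_Suc_shift of_nat_mult mult.assoc by (simp del: binomial_Suc_Suc of_nat_Suc)
  also have "\<dots> = int h * y * (\<Sum>m\<le>g. int (g choose m) * y ^ m)"
    unfolding Suc_times_binomial h by (simp add: sum_distrib_left algebra_simps)
  also have "(\<Sum>m\<le>g. int (g choose m) * y ^ m) = (1 + y) ^ g"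
    using binomial_ring[of y 1 g] by (simp add: add.commute)
  finally show ?thesis by (simp add: h)
qed

lemma sum_abs_dev_cong:
  assumes "prime p" "p = 2 * h + 1"
  shows "[\<Sum>n<p. abs_dev n * x ^ n =
    2 * ((1 + 2 * x) * (int h * (-4 * x\<^sup>2) * (1 - 4 * x\<^sup>2) ^ (h - 1)) + x * (1 - 4 * x\<^sup>2) ^ h)]
    (mod int p)"
proof -
  have "h > 0" using assms by (cases h) auto
  let ?y = "-4 * x\<^sup>2"
  \<comment> \<open>The indices 2m and 2m + 1 are paired, since \<open>abs_dev\<close> involves the
    same central binomial at both.\<close>
  have split: "(\<Sum>n<2 * N. abs_dev n * x ^ n) =
      (\<Sum>m<N. 2 * (int m * (1 + 2 * x) + x) * (int (2 * m choose m) * x ^ (2 * m)))" for N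
  proof (induction N)
    case (Suc N)
    have "2 * Suc N = Suc (Suc (2 * N))" by simp
    then show ?case
      by (simp only: sum.lessThan_Suc abs_dev_even abs_dev_odd Suc.IH power_Suc) (simp add: algebra_simps)
  qed simp
  \<comment> \<open>The range n < p leaves n = 2h unpaired. Its partner n = p may be added because
    its term vanishes modulo p.\<close>
  have "abs_dev p = int p * (2 * int (2 * h choose h))"
    using abs_dev_odd[of h] assms(2) by simp
  then have "[\<Sum>n<p. abs_dev n * x ^ n = \<Sum>n<Suc p. abs_dev n * x ^ n] (mod int p)"
    by (simp add: cong_iff_dvd_diff)
  also have "Suc p = 2 * Suc h" using assms(2) by simp
  also have "(\<Sum>n<2 * Suc h. abs_dev n * x ^ n) =
      (\<Sum>m\<le>h. 2 * (int m * (1 + 2 * x) + x) * (int (2 * m choose m) * x ^ (2 * m)))"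
    unfolding split lessThan_Suc_atMost ..
  also have "[\<dots> = (\<Sum>m\<le>h. 2 * (int m * (1 + 2 * x) + x) *
      (((-4) ^ m * int (h choose m)) * x ^ (2 * m)))] (mod int p)"
    by (intro cong_sum cong_mult cong_refl central_binomial_cong[OF assms]) simp
  also have "(\<Sum>m\<le>h. 2 * (int m * (1 + 2 * x) + x) * (((-4) ^ m * int (h choose m)) * x ^ (2 * m))) =
      (\<Sum>m\<le>h. 2 * ((1 + 2 * x) * (int m * (int (h choose m) * ?y ^ m)) + x * (int (h choose m) * ?y ^ m)))"
    by (intro sum.cong refl) (simp only: power_mult power_mult_distrib, simp add: algebra_simps)
  also have "\<dots> = 2 * ((1 + 2 * x) * (\<Sum>m\<le>h. int m * (int (h choose m) * ?y ^ m)) +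
      x * (\<Sum>m\<le>h. int (h choose m) * ?y ^ m))"
    by (simp only: sum.distrib sum_distrib_left[symmetric])
  also have "(\<Sum>m\<le>h. int (h choose m) * ?y ^ m) = (1 - 4 * x\<^sup>2) ^ h"
    using binomial_ring[of ?y 1 h] by (simp add: add.commute)
  also have "(\<Sum>m\<le>h. int m * (int (h choose m) * ?y ^ m)) = int h * ?y * (1 - 4 * x\<^sup>2) ^ (h - 1)"
    using sum_times_binomial[OF \<open>h > 0\<close>, of ?y] by simp
  finally show ?thesis .
qed

text \<open>Telescoping of (n + 1) z^(n+1) - n z^n = (z - 1) n z^n + z^(n+1).\<close>

lemma sum_times_power:
  fixes z :: int
  shows "(z - 1) * (\<Sum>n<N. int n * z ^ n) = int N * z ^ N - z * (\<Sum>n<N. z ^ n)"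
  by (induction N) (simp_all add: algebra_simps)

lemma fermat_int:
  assumes "prime p"
  shows "[z ^ p = z] (mod int p)"
proof (cases "int p dvd z")
  case True
  then have "int p dvd z ^ p" using assms by (simp add: dvd_power_iff prime_gt_0_nat dvd_trans)
  with True show ?thesis by (metis cong_iff_dvd_diff dvd_diff)
next
  case False
  \<comment> \<open>\<open>fermat_theorem\<close> concerns naturals, so z is replaced by its
    residue.\<close>
  then have "\<not> p dvd nat (z mod int p)"
    using assms by (metis dvd_mod_iff dvd_refl int_dvd_int_iff int_nat_eq of_nat_0 pos_mod_sign prime_gt_0_nat of_nat_0_less_iff)
  then have "[int (nat (z mod int p) ^ (p - 1)) = int 1] (mod int p)"
    using fermat_theorem[OF assms] by (simp only: cong_int_iff)
  then have "[(z mod int p) ^ (p - 1) = 1] (mod int p)"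
    using prime_gt_0_nat[OF assms] by simp
  then have "[z ^ (p - 1) = 1] (mod int p)"
    by (simp add: cong_def power_mod)
  then have "[z * z ^ (p - 1) = z * 1] (mod int p)" by (intro cong_mult cong_refl)
  then show ?thesis using prime_gt_0_nat[OF assms] by (metis mult.right_neutral power_minus_mult mult.commute)
qed

text \<open>By Fermat the geometric sum times z - 1 is z^p - 1, congruent to z - 1, so the geometric
  sum is congruent to 1.\<close>

lemma sum_times_power_cong:
  assumes "prime p" "\<not> int p dvd z - 1"
  shows "[(z - 1) * (\<Sum>n<p. int n * z ^ n) = - z] (mod int p)"
proof -
  have "(z - 1) * (\<Sum>n<p. z ^ n) = z ^ p - 1"
    by (rule power_diff_1_eq[symmetric])
  then have "[(z - 1) * (\<Sum>n<p. z ^ n) = (z - 1) * 1] (mod int p)"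
    using cong_diff[OF fermat_int[OF assms(1), of z] cong_refl[of 1]] by simp
  moreover have "coprime (z - 1) (int p)"
    using assms by (simp add: coprime_commute prime_imp_coprime)
  ultimately have "[\<Sum>n<p. z ^ n = 1] (mod int p)"
    using cong_mult_lcancel by blast
  then have "[int p * z ^ p - z * (\<Sum>n<p. z ^ n) = 0 - z * 1] (mod int p)"
    by (intro cong_diff cong_mult cong_refl) (simp add: cong_def)
  then show ?thesis by (simp add: sum_times_power)
qed

section \<open>Reduction of the sum to diagonals\<close>

text \<open>The doubling avoids the half in max i (n - i) = (n + |n - 2i|) / 2; it is cancelled at
  the end, p being odd.\<close>

lemma sum_S0_cong:
  assumes "prime p"
  shows "[2 * (\<Sum>k=0..p-1. S0 k x) =
    - ((\<Sum>n<p. int n * (2 * x) ^ n) + (\<Sum>n<p. abs_dev n * x ^ n))] (mod int p)"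
proof -
  let ?f = "\<lambda>i j. int (i + j choose i) * x ^ (i + j)"
  define M where "M n = (\<Sum>i\<le>n. int (max i (n - i)) * int (n choose i))" for n
  have "{0..p-1} = {..<p}" using prime_gt_0_nat[OF assms] by auto
  then have "(\<Sum>k=0..p-1. S0 k x) = (\<Sum>k<p. \<Sum>i\<le>k. \<Sum>j\<le>k. ?f i j)"
    by (simp add: S0_def atLeast0AtMost)
  also have "\<dots> = (\<Sum>(i, j)\<in>{..<p} \<times> {..<p}. int (p - max i j) * ?f i j)" (is "_ = ?A")
    unfolding sum_squares_eq_sum_max by (simp only: sum.cartesian_product)
  finally have sum_S0: "(\<Sum>k=0..p-1. S0 k x) = ?A" .
  have "[?A = (\<Sum>(i, j)\<in>{..<p} \<times> {..<p}. if i + j < p then - int (max i j) * ?f i j else 0)]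
      (mod int p)"
  proof (intro cong_sum, clarify)
    fix i j assume ij: "i < p" "j < p"
    show "[int (p - max i j) * ?f i j = (if i + j < p then - int (max i j) * ?f i j else 0)]
        (mod int p)"
    proof (cases "i + j < p")
      case True
      have "int (p - max i j) = int p - int (max i j)" using ij by (simp add: of_nat_diff)
      then have "int (p - max i j) * ?f i j - - int (max i j) * ?f i j = int p * ?f i j"
        by (simp only:) (simp add: algebra_simps)
      with True show ?thesis by (simp only: cong_iff_dvd_diff if_True) simp
    next
      case False
      then have "int p dvd int (i + j choose i)"
        using prime_dvd_choose_add[OF assms ij] by (simp only: int_dvd_int_iff not_less)
      with False show ?thesis by (simp add: cong_iff_dvd_diff)
    qed
  qed
  also have "(\<Sum>(i, j)\<in>{..<p} \<times> {..<p}. if i + j < p then - int (max i j) * ?f i j else 0) =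
      (\<Sum>(i, j)\<in>{(i, j). i + j < p}. - int (max i j) * ?f i j)"
  proof -
    \<comment> \<open>The triangle lies inside the square, so no bounds on i and j need to be kept
      before regrouping by diagonals.\<close>
    have "{(i, j). i + j < p} = {z \<in> {..<p} \<times> {..<p}. fst z + snd z < p}" by auto
    then show ?thesis
      by (simp only: sum.inter_filter finite_cartesian_product finite_lessThan case_prod_unfold)
  qed
  also have "\<dots> = (\<Sum>n<p. \<Sum>i\<le>n. - int (max i (n - i)) * ?f i (n - i))"
    by (rule sum.triangle_reindex)
  also have "\<dots> = - (\<Sum>n<p. M n * x ^ n)"
    unfolding M_def sum_distrib_right sum_negf[symmetric]
    by (intro sum.cong refl) (simp add: mult.assoc)
  finally have "[2 * (\<Sum>k=0..p-1. S0 k x) = 2 * - (\<Sum>n<p. M n * x ^ n)] (mod int p)"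
    unfolding sum_S0 by (rule cong_scalar_left)
  moreover have "2 * - (\<Sum>n<p. M n * x ^ n) = - (\<Sum>n<p. (2 * M n) * x ^ n)"
    by (simp add: sum_distrib_left mult.assoc)
  moreover have "(2 * M n) * x ^ n = int n * (2 * x) ^ n + abs_dev n * x ^ n" for n
    unfolding M_def sum_max_binomial by (simp add: power_mult_distrib algebra_simps)
  ultimately show ?thesis by (simp only: sum.distrib)
qed

section \<open>From integer congruences to rational ones\<close>

text \<open>The fraction need not be reduced, but its reduced denominator n divides d: a n = m d
  with m and n coprime.\<close>

lemma p_integral_divide:
  assumes "coprime d (int p)" "d \<noteq> 0"
  shows "p_integral p (of_int a / of_int d)"
proof -
  obtain m n where q: "quotient_of (of_int a / of_int d) = (m, n)" by fastforce
  have n: "n > 0" "coprime m n" "(of_int a / of_int d :: rat) = of_int m / of_int n"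
    using quotient_of_denom_pos[OF q] quotient_of_coprime[OF q] quotient_of_div[OF q] by auto
  then have "of_int (a * n) = (of_int (m * d) :: rat)"
    using assms(2) by (simp add: field_simps)
  then have "a * n = m * d" by (simp only: of_int_eq_iff)
  then have "n dvd m * d" by (metis dvd_triv_right)
  then have "n dvd d"
    using n(2) by (simp add: coprime_dvd_mult_right_iff coprime_commute)
  then have "coprime n (int p)"
    using coprime_divisors[OF _ dvd_refl assms(1)] by blast
  then show ?thesis
    by (simp add: p_integral_def q)
qed

lemma rat_cong_divide:
  assumes "coprime d (int p)" "d \<noteq> 0" "[d * a = b] (mod int p)"
  shows "rat_cong p (of_int a) (of_int b / of_int d)"
proof -
  obtain k where "d * a - b = int p * k"
    using assms(3) by (auto simp: cong_iff_dvd_diff)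
  then have "of_int d * of_int a - of_int b = (of_nat p * of_int k :: rat)"
    by (metis of_int_diff of_int_mult of_int_of_nat_eq)
  then have "of_int a - of_int b / of_int d = of_nat p * (of_int k / of_int d :: rat)"
    using assms(2) by (simp add: field_simps)
  then show ?thesis
    unfolding rat_cong_def using p_integral_divide[OF assms(1,2)] p_integral_of_int by blast
qed

section \<open>The generic and the exceptional residue class of x\<close>

theorem theorem1p2:
  fixes p :: nat and x :: int
  assumes "prime p" and "odd p"
  shows "(\<not> int p dvd 2 * x - 1 \<longrightarrow>
            rat_cong p (of_int (\<Sum>k=0..p-1. S0 k x))
              (of_int x / of_int (2 * x - 1) * (1 + of_int (Legendre (1 - 4 * x^2) (int p))))) \<and>
         (int p dvd 2 * x - 1 \<longrightarrow>
            [(\<Sum>k=0..p-1. S0 k x) = - (if p = 3 then 1 else 0)] (mod int p))"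
proof -
  define T where "T = (\<Sum>k=0..p-1. S0 k x)"
  define F where "F = (\<Sum>n<p. int n * (2 * x) ^ n)"
  define w where "w = 1 - 4 * x\<^sup>2"
  define h where "h = (p - 1) div 2"
  \<comment> \<open>Half of the closed form of the \<open>abs_dev\<close> sum.\<close>
  define E where "E = (1 + 2 * x) * (int h * (-4 * x\<^sup>2) * w ^ (h - 1)) + x * w ^ h"
  have h: "p = 2 * h + 1" using \<open>odd p\<close> by (auto simp: h_def elim!: oddE)
  have "h > 0" using assms(1) h by (cases h) auto
  have two: "coprime 2 (int p)" using assms(2) by simp
  have T: "[2 * T = - (F + 2 * E)] (mod int p)"
    using cong_trans[OF sum_S0_cong[OF assms(1), of x]
        cong_minus_minus_iff[THEN iffD2, OF cong_add[OF cong_refl sum_abs_dev_cong[OF assms(1) h, of x]]]]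
    unfolding T_def F_def E_def w_def .
  show ?thesis
    unfolding T_def[symmetric]
  proof (intro conjI impI)
    assume nd: "\<not> int p dvd 2 * x - 1"
    define L where "L = Legendre (1 - 4 * x^2) (int p)"
    have "[L = w ^ h] (mod int p)"
      using euler_criterion[OF assms(1)] assms h prime_ge_2_nat[OF assms(1)] \<open>h > 0\<close>
      unfolding L_def w_def h_def by auto
    \<comment> \<open>Since w = (1 - 2x)(1 + 2x), the factor 1 - 2x completes w^(h-1) to w^h. The
      coefficient of w^h then becomes x - 2x^2 (2h + 1), and 2h + 1 = p.\<close>
    have "(1 - 2 * x) * E = (int h * (-4 * x\<^sup>2)) * (w * w ^ (h - 1)) + x * (1 - 2 * x) * w ^ h"
      unfolding E_def by (simp add: w_def power2_eq_square algebra_simps)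
    also have "w * w ^ (h - 1) = w ^ h" using \<open>h > 0\<close> by (simp add: power_eq_if)
    also have "int h * (-4 * x\<^sup>2) * w ^ h + x * (1 - 2 * x) * w ^ h =
        x * w ^ h - int p * (2 * x\<^sup>2 * w ^ h)"
      unfolding h by (simp add: algebra_simps power2_eq_square)
    finally have "[(1 - 2 * x) * E = x * w ^ h] (mod int p)"
      by (simp add: cong_iff_dvd_diff)
    then have E: "[(1 - 2 * x) * E = x * L] (mod int p)"
      using cong_trans cong_scalar_left[OF cong_sym[OF \<open>[L = w ^ h] (mod int p)\<close>]] by blast
    have F: "[(2 * x - 1) * F = - (2 * x)] (mod int p)"
      unfolding F_def using sum_times_power_cong[OF assms(1) nd] .
    have "[(2 * x - 1) * (2 * T) = (2 * x - 1) * - (F + 2 * E)] (mod int p)"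
      using T by (rule cong_scalar_left)
    also have "(2 * x - 1) * - (F + 2 * E) = 2 * ((1 - 2 * x) * E) - (2 * x - 1) * F"
      by (simp add: algebra_simps)
    also have "[\<dots> = 2 * (x * L) - - (2 * x)] (mod int p)"
      by (intro cong_diff cong_scalar_left E F)
    finally have "[2 * ((2 * x - 1) * T) = 2 * (x * (1 + L))] (mod int p)"
      by (simp add: algebra_simps)
    then have *: "[(2 * x - 1) * T = x * (1 + L)] (mod int p)"
      using cong_mult_lcancel[OF two] by blast
    have "coprime (2 * x - 1) (int p)"
      using assms(1) nd by (simp add: coprime_commute prime_imp_coprime)
    moreover have "2 * x - 1 \<noteq> 0" using nd by force
    ultimately have "rat_cong p (of_int T) (of_int (x * (1 + L)) / of_int (2 * x - 1))"
      using * by (rule rat_cong_divide)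
    then show "rat_cong p (of_int T)
        (of_int x / of_int (2 * x - 1) * (1 + of_int (Legendre (1 - 4 * x^2) (int p))))"
      unfolding L_def by simp
  next
    assume d: "int p dvd 2 * x - 1"
    then have z: "[2 * x = 1] (mod int p)" by (simp add: cong_iff_dvd_diff)
    \<comment> \<open>Here the factor 2x - 1 cannot be cancelled, so \<open>F\<close> is evaluated
      directly at 2x = 1.\<close>
    have "[F = \<Sum>n<p. int n * 1 ^ n] (mod int p)"
      unfolding F_def by (intro cong_sum cong_mult cong_pow cong_refl z)
    moreover have "(\<Sum>n<p. int n) = int p * int h"
    proof -
      have "2 * (\<Sum>n<N. int n) = int N * (int N - 1)" for N
        by (induction N) (simp_all add: algebra_simps)
      from this[of p] show ?thesis using h by simp
    qed
    ultimately have F: "[F = 0] (mod int p)" by (simp add: cong_def)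
    have "w = (2 * x - 1) * (- (1 + 2 * x))"
      by (simp add: w_def power2_eq_square algebra_simps)
    then have w: "int p dvd w" using d by simp
    show "[T = - (if p = 3 then 1 else 0)] (mod int p)"
    \<comment> \<open>w is divisible by p, so \<open>E\<close> vanishes modulo p unless the exponent
      h - 1 is 0, which happens only for p = 3. There -4x^2 = w - 1 gives E = -2, hence 2T = 4 and T
      = 2 = -1 modulo 3.\<close>
    proof (cases "p = 3")
      case True
      then have "h = 1" using h by simp
      then have "E = (1 + 2 * x) * (w - 1) + x * w" by (simp add: E_def w_def)
      also have "[\<dots> = (1 + 1) * (0 - 1) + x * 0] (mod int p)"
        using w by (intro cong_add cong_mult cong_diff cong_refl z) (simp_all add: cong_0_iff)
      finally have "[- (F + 2 * E) = - (0 + 2 * ((1 + 1) * (0 - 1) + x * 0))] (mod int p)"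
        by (intro cong_minus_minus_iff[THEN iffD2] cong_add cong_scalar_left F)
      with T have "[2 * T = 4] (mod int p)" using cong_trans by fastforce
      then have "[2 * T = 2 * 2] (mod int p)" by simp
      then have "[T = 2] (mod int p)" using cong_mult_lcancel[OF two] by blast
      moreover have "[2 = - 1] (mod int p)" using True by (simp add: cong_iff_dvd_diff)
      ultimately show ?thesis using True by (auto intro: cong_trans)
    next
      case False
      then have "h > 1" using h \<open>h > 0\<close> by auto
      then have "int p dvd w ^ (h - 1)" "int p dvd w ^ h"
        using w by (simp_all add: dvd_power dvd_trans[OF w])
      then have "[E = 0] (mod int p)" by (simp add: E_def cong_0_iff)
      then have "[- (F + 2 * E) = - (0 + 2 * 0)] (mod int p)"
        by (intro cong_minus_minus_iff[THEN iffD2] cong_add cong_scalar_left F)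
      with T have "[2 * T = 2 * 0] (mod int p)" using cong_trans by fastforce
      then have "[T = 0] (mod int p)" using cong_mult_lcancel[OF two] by blast
      then show ?thesis using False by simp
    qed
  qed
qed

end
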